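(* For every integer $k\ge 4$, there is no graph $G$ with $\omega(G)=2$, $\chi(G)=k$ and $\chi_{\rho}(G)=k+2$; that is, the triple $(2,k,k+2)$ is not realizable.
   Context: All graphs are finite and simple. $\omega(G)$ is the clique number and $\chi(G)$ the chromatic number of $G$. For a positive integer $i$, an $i$-packing in $G$ is a set $W\subseteq V(G)$ such that any two distinct vertices of $W$ are at distance greater than $i$ in $G$. The packing chromatic number $\chi_{\rho}(G)$ is the smallest integer $k$ such that $V(G)$ can be partitioned into sets $V_1,\dots,V_k$ with $V_i$ an $i$-packing for each $i\in\{1,\dots,k\}$. A triple $(a,b,c)$ is realizable if some graph $G$ has $\omega(G)=a$, $\chi(G)=b$, $\chi_{\rho}(G)=c$. *)

theory Defs
  imports "Graph_Theory.Graph_Theory" "HOL-Library.Disjoint_Sets"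
begin

text \<open>
  A finite simple graph is a \<open>pair_graph\<close>: a finite, symmetric, loop-free set of arcs, so an edge
  \<open>uv\<close> is represented by the two arcs \<open>(u, v)\<close> and \<open>(v, u)\<close>.
\<close>

definition is_clique :: "'a pair_pre_digraph \<Rightarrow> 'a set \<Rightarrow> bool" where
  "is_clique G K \<longleftrightarrow> K \<subseteq> pverts G \<and> (\<forall>u\<in>K. \<forall>v\<in>K. u \<noteq> v \<longrightarrow> (u, v) \<in> parcs G)"

definition clique_number :: "'a pair_pre_digraph \<Rightarrow> nat" where
  "clique_number G = Max {card K |K. is_clique G K}"

definition proper_coloring :: "'a pair_pre_digraph \<Rightarrow> nat \<Rightarrow> ('a \<Rightarrow> nat) \<Rightarrow> bool" where
  "proper_coloring G k c \<longleftrightarrow>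
     (\<forall>v\<in>pverts G. c v \<in> {1..k}) \<and> (\<forall>(u, v)\<in>parcs G. c u \<noteq> c v)"

definition chromatic_number :: "'a pair_pre_digraph \<Rightarrow> nat" where
  "chromatic_number G = (LEAST k. \<exists>c. proper_coloring G k c)"

text \<open>
  The length of a shortest walk; it is \<open>\<infinity>\<close> for vertices in different components.
\<close>
definition graph_dist :: "'a pair_pre_digraph \<Rightarrow> 'a \<Rightarrow> 'a \<Rightarrow> ereal" where
  "graph_dist G u v = wf_digraph.\<mu> (with_proj G) (\<lambda>_. 1) u v"

definition is_packing :: "'a pair_pre_digraph \<Rightarrow> nat \<Rightarrow> 'a set \<Rightarrow> bool" where
  "is_packing G i W \<longleftrightarrow>
     W \<subseteq> pverts G \<and> (\<forall>u\<in>W. \<forall>v\<in>W. u \<noteq> v \<longrightarrow> graph_dist G u v > ereal (real i))"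

text \<open>
  Empty classes are allowed, which does not affect the least \<open>k\<close>: an empty class \<open>V i\<close> with
  \<open>i < k\<close> could be replaced by \<open>V k\<close>, since every \<open>k\<close>-packing is an \<open>i\<close>-packing.
\<close>
definition packing_partition :: "'a pair_pre_digraph \<Rightarrow> nat \<Rightarrow> (nat \<Rightarrow> 'a set) \<Rightarrow> bool" where
  "packing_partition G k V \<longleftrightarrow>
     (\<Union>i\<in>{1..k}. V i) = pverts G \<and> disjoint_family_on V {1..k} \<and>
     (\<forall>i\<in>{1..k}. is_packing G i (V i))"

definition packing_chromatic_number :: "'a pair_pre_digraph \<Rightarrow> nat" where
  "packing_chromatic_number G = (LEAST k. \<exists>V. packing_partition G k V)"

end

theory Submission
  imports Defs
begin

text \<open>
  Let a triangle-free graph have a packing colouring with \<open>k + 2\<close> colours. Keeping the colours above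
  \<open>6\<close>, it suffices to recolour the vertices of colours \<open>1, \<dots>, 6\<close> with three colours. In the
  subgraph on the colours \<open>2, \<dots>, 6\<close> every odd cycle is a pentagon, because there is no long word in
  these letters in which equal letters \<open>i\<close> are more than \<open>i\<close> apart; a pentagon uses each of the five
  colours once. Hence deleting the set \<open>Z\<close> of colour-\<open>2\<close> vertices on pentagons leaves a bipartite
  graph \<open>B\<close>. A vertex of colour \<open>1\<close> next to \<open>Z\<close> has at most one neighbour in \<open>B\<close>: the pentagon is so
  near that it blocks the other candidates. So \<open>Z\<close> can take over colour \<open>1\<close>, and the neighbours of
  \<open>Z\<close> that had colour \<open>1\<close> join the 2-colouring of \<open>B\<close>.
\<close>

section \<open>Odd closed walks and 2-colourings\<close>

text \<open>Colour each vertex by the parity of the walks from a representative of its component; an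
  edge with equally coloured ends would close an odd walk.\<close>

lemma two_colouring_of_no_odd_closed_walk:
  assumes sym: "sym R"
    and odd_free: "\<And>v n. odd n \<Longrightarrow> (v, v) \<notin> R ^^ n"
  shows "\<exists>g :: 'a \<Rightarrow> bool. \<forall>(u, v)\<in>R. g u \<noteq> g v"
proof -
  \<comment> \<open>The choice depends only on the set of reachable vertices, so a whole component
    shares one representative.\<close>
  define r where "r x = (SOME y. (x, y) \<in> R\<^sup>*)" for x
  define g where "g x \<longleftrightarrow> (\<exists>n. even n \<and> (r x, x) \<in> R ^^ n)" for x
  have sym_pow: "(y, x) \<in> R ^^ n" if "(x, y) \<in> R ^^ n" for x y n
    using that
  proof (induction n arbitrary: y)
    case (Suc n)
    then obtain z where "(x, z) \<in> R ^^ n" "(z, y) \<in> R" by auto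
    with Suc.IH sym show ?case by (meson relpow_Suc_I2 symD)
  qed simp
  have sym_star: "(y, x) \<in> R\<^sup>*" if "(x, y) \<in> R\<^sup>*" for x y
    using that sym_pow by (meson rtrancl_imp_relpow relpow_imp_rtrancl)
  have "g u \<noteq> g v" if uv: "(u, v) \<in> R" for u v
  proof -
    have "(u, w) \<in> R\<^sup>* \<longleftrightarrow> (v, w) \<in> R\<^sup>*" for w
      using uv sym by (meson converse_rtrancl_into_rtrancl symD)
    then have r_eq: "r v = r u" unfolding r_def by simp
    have "(u, r u) \<in> R\<^sup>*" unfolding r_def by (rule someI[of _ u]) simp
    then have reach: "(r u, u) \<in> R\<^sup>*" by (rule sym_star)
    show ?thesis
    proof
      assume eq: "g u = g v"
      show False
      proof (cases "g u")
        case True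
        then obtain m n where m: "even m" "(r u, u) \<in> R ^^ m" and n: "even n" "(r u, v) \<in> R ^^ n"
          using eq r_eq unfolding g_def by auto
        from m(2) uv have "(r u, v) \<in> R ^^ Suc m" by auto
        then have "(r u, r u) \<in> R ^^ (Suc m + n)"
          using sym_pow[OF n(2)] by (auto simp only: relpow_add)
        then show False using odd_free[of "Suc m + n"] m n by auto
      next
        case False
        obtain m where m: "(r u, u) \<in> R ^^ m" using reach by (meson rtrancl_imp_relpow)
        then have "odd m" using False unfolding g_def by blast
        moreover have "(r v, v) \<in> R ^^ Suc m" using m uv r_eq by auto
        ultimately have "g v" unfolding g_def by (meson even_Suc)
        with eq False show False by simp
      qed
    qed
  qed
  then show ?thesis by blast
qed

text \<open>A repeated vertex would split a shortest odd closed walk into two shorter closed walks,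
  one of them odd. The periodic form of \<open>s\<close> lets segments run past the end of the
  walk.\<close>

lemma shortest_odd_closed_walk:
  assumes "(v, v) \<in> R ^^ n0" "odd n0"
  obtains n s where "odd n" "\<And>i. s (i + n) = s i" "\<And>i. (s i, s (Suc i)) \<in> R" "inj_on s {..<n}"
proof -
  define P where "P n \<longleftrightarrow> odd n \<and> (\<exists>v. (v, v) \<in> R ^^ n)" for n
  define n where "n = (LEAST n. P n)"
  have "P n0" using assms unfolding P_def by blast
  then have Pn: "P n" unfolding n_def by (rule LeastI)
  have least: "n \<le> m" if "P m" for m unfolding n_def using that by (rule Least_le)
  from Pn obtain w f where n: "odd n" and f: "f 0 = w" "f n = w" "\<And>i. i < n \<Longrightarrow> (f i, f (Suc i)) \<in> R"
    unfolding P_def by (metis relpow_fun_conv)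
  have n0: "0 < n" using n by (rule odd_pos)
  have seg: "(f i, f j) \<in> R ^^ (j - i)" if "i \<le> j" "j \<le> n" for i j
    unfolding relpow_fun_conv using that f(3) by (intro exI[of _ "\<lambda>t. f (i + t)"]) auto
  have inj: "f i \<noteq> f j" if ij: "i < j" "j < n" for i j
  proof
    assume eq: "f i = f j"
    have 1: "(f i, f i) \<in> R ^^ (j - i)" using seg[of i j] ij eq by simp
    have "(f j, f n) \<in> R ^^ (n - j)" "(f 0, f i) \<in> R ^^ i" using seg[of j n] seg[of 0 i] ij by auto
    then have "(f i, f i) \<in> R ^^ (n - j + i)"
      using f eq by (auto simp: relpow_add)
    moreover have "n = (j - i) + (n - j + i)" using ij by simp
    then have "odd (j - i) \<or> odd (n - j + i)" using n by (metis even_add)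
    ultimately have "P (j - i) \<or> P (n - j + i)" unfolding P_def using 1 by blast
    then show False using least[of "j - i"] least[of "n - j + i"] ij by auto
  qed
  define s where "s i = f (i mod n)" for i
  have "(s i, s (Suc i)) \<in> R" for i
  proof (cases "Suc (i mod n) = n")
    case True
    then have "s (Suc i) = f n" unfolding s_def using f by (simp add: mod_Suc)
    then show ?thesis unfolding s_def using f(3)[of "i mod n"] True by simp
  next
    case False
    then have "s (Suc i) = f (Suc (i mod n))" unfolding s_def by (simp add: mod_Suc)
    then show ?thesis unfolding s_def using f(3)[of "i mod n"] n0 by simp
  qed
  moreover have "inj_on s {..<n}"
    unfolding s_def by (intro linorder_inj_onI) (use inj in auto)
  ultimately show ?thesis using that[of n s] n unfolding s_def by simp
qed

section \<open>Distances, cliques and packing partitions\<close>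

lemma graph_dist_le_of_relpow:
  assumes G: "pair_wf_digraph G" and "(u, v) \<in> parcs G ^^ n" "u \<in> pverts G"
  shows "graph_dist G u v \<le> ereal (real n)"
proof -
  interpret pair_wf_digraph G by (rule G)
  have "\<exists>p. awalk u p v \<and> length p = n"
    using assms(2,3)
  proof (induction n arbitrary: u)
    case 0
    then show ?case by (auto simp: awalk_Nil_iff)
  next
    case (Suc n)
    from Suc.prems(1) obtain w where w: "(u, w) \<in> parcs G" "(w, v) \<in> parcs G ^^ n"
      by (meson relpow_Suc_E2)
    then have "w \<in> pverts G" using in_arcsD2 by blast
    with Suc.IH w obtain p where "awalk w p v" "length p = n" by blast
    with w show ?case by (intro exI[of _ "(u, w) # p"]) (auto simp: awalk_Cons_iff)
  qed
  then obtain p where p: "awalk u p v" "length p = n" by blast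
  have "awalk_cost (\<lambda>_. 1) p = real (length p)" unfolding awalk_cost_def by (simp add: sum_list_triv)
  with min_cost_le_walk_cost[OF p(1), of "\<lambda>_. 1"] p(2) show ?thesis unfolding graph_dist_def by simp
qed

lemma clique_card_le_clique_number:
  assumes "finite (pverts G)" "is_clique G K"
  shows "card K \<le> clique_number G"
  unfolding clique_number_def
proof (rule Max_ge)
  have "{card K |K. is_clique G K} \<subseteq> card ` Pow (pverts G)"
    unfolding is_clique_def by auto
  then show "finite {card K |K. is_clique G K}" using assms(1) by (meson finite_Pow_iff finite_imageI finite_subset)
  show "card K \<in> {card K |K. is_clique G K}" using assms(2) by blast
qed

text \<open>Singletons are \<open>i\<close>-packings for every \<open>i\<close>; hence the least
  number of classes is attained.\<close>

lemma packing_partition_exists: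
  assumes "finite (pverts G)"
  shows "\<exists>n V. packing_partition G n V"
proof -
  from ex_bij_betw_nat_finite_1[OF assms] obtain h where
    h: "bij_betw h {1..card (pverts G)} (pverts G)" by blast
  have "packing_partition G (card (pverts G)) (\<lambda>i. {h i})"
    unfolding packing_partition_def is_packing_def disjoint_family_on_def
    using h bij_betw_imp_surj_on[OF h] bij_betw_imp_inj_on[OF h] by (auto dest: inj_onD bij_betwE)
  then show ?thesis by blast
qed

lemma packing_partition_packing_chromatic_number:
  assumes "finite (pverts G)"
  shows "\<exists>V. packing_partition G (packing_chromatic_number G) V"
  unfolding packing_chromatic_number_def using packing_partition_exists[OF assms] by (rule LeastI_ex)

section \<open>Words in which equal letters are far apart\<close>

text \<open>
  \<open>xs\<close> is read backwards: its head is the last letter of the word to be prolonged by \<open>n\<close> letters.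
\<close>
fun word_ext :: "nat list \<Rightarrow> nat \<Rightarrow> nat list \<Rightarrow> bool" where
  "word_ext C 0 xs \<longleftrightarrow> True"
| "word_ext C (Suc n) xs \<longleftrightarrow> list_ex (\<lambda>c. c \<notin> set (take c xs) \<and> word_ext C n (c # xs)) C"

text \<open>The sequence itself supplies the letter chosen at each level of the search.\<close>

lemma word_ext_of_sequence:
  fixes s :: "nat \<Rightarrow> nat"
  assumes "\<And>i d. 0 < d \<Longrightarrow> d \<le> s i \<Longrightarrow> s (i + d) \<noteq> s i"
    and "\<And>i. b \<le> i \<Longrightarrow> i < b + n \<Longrightarrow> s i \<in> set C"
    and "a \<le> b"
  shows "word_ext C n (rev (map s [a..<b]))"
  using assms(2,3)
proof (induction n arbitrary: b)
  case (Suc n)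
  have "s b \<notin> set (take (s b) (rev (map s [a..<b])))"
  proof
    assume "s b \<in> set (take (s b) (rev (map s [a..<b])))"
    \<comment> \<open>Position \<open>t\<close> of the reversed word lies \<open>Suc t\<close>
      letters back, and \<open>Suc t\<close> is at most \<open>s b\<close>.\<close>
    then obtain t where t: "t < s b" "t < b - a" "s b = s (b - Suc t)"
      using \<open>a \<le> b\<close> by (fastforce simp: in_set_conv_nth rev_nth)
    then have "s (b - Suc t + Suc t) \<noteq> s (b - Suc t)" by (intro assms(1)) auto
    with t show False by simp
  qed
  moreover have "word_ext C n (rev (map s [a..<Suc b]))"
    using Suc.prems by (intro Suc.IH) auto
  moreover have "s b \<in> set C" using Suc.prems by simp
  ultimately show ?case using \<open>a \<le> b\<close> by (auto simp: list_ex_iff)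
qed simp

text \<open>
  Starting the second search at a letter \<open>6\<close>, which the first one provides, keeps the search tree
  small enough for the simplifier.
\<close>
lemma no_word_2_to_5: "\<not> word_ext [2, 3, 4, 5] 9 []"
  by code_simp

lemma no_word_2_to_6: "\<not> word_ext [2, 3, 4, 5, 6] 29 [6]"
  by code_simp

text \<open>The first search forces a letter 6, and the second one fails from there.\<close>

lemma no_packing_sequence:
  fixes s :: "nat \<Rightarrow> nat"
  assumes pack: "\<And>i d. 0 < d \<Longrightarrow> d \<le> s i \<Longrightarrow> s (i + d) \<noteq> s i"
    and range: "\<And>i. s i \<in> {2..6}"
  shows False
proof -
  have six: "s i \<in> set [2, 3, 4, 5, 6]" for i using range[of i] by auto
  have "\<exists>i. s i = 6"
  proof (rule ccontr)
    assume "\<nexists>i. s i = 6"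
    then have "s i \<in> set [2, 3, 4, 5]" for i using six[of i] by auto
    then have "word_ext [2, 3, 4, 5] 9 (rev (map s [0..<0]))"
      using pack by (intro word_ext_of_sequence) auto
    with no_word_2_to_5 show False by simp
  qed
  then obtain i where "s i = 6" ..
  moreover have "word_ext [2, 3, 4, 5, 6] 29 (rev (map s [i..<Suc i]))"
    using pack six by (intro word_ext_of_sequence) auto
  ultimately show False using no_word_2_to_6 by simp
qed

section \<open>Recolouring the first six colours of a triangle-free graph\<close>

text \<open>Distances are replaced by lengths of walks, and no vertex set is fixed: \<open>f\<close>
  is positive everywhere. Colours above 6 may occur.\<close>

locale triangle_free_packing =
  fixes E :: "('a \<times> 'a) set" and f :: "'a \<Rightarrow> nat"
  assumes sym: "sym E"
    and triangle_free: "\<And>x y z. (x, y) \<in> E \<Longrightarrow> (y, z) \<in> E \<Longrightarrow> (z, x) \<notin> E"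
    and pos: "\<And>v. 1 \<le> f v"
    and pack: "\<And>u v m. (u, v) \<in> E ^^ m \<Longrightarrow> u \<noteq> v \<Longrightarrow> f u = f v \<Longrightarrow> f u < m"
begin

lemma irrefl: "(x, x) \<notin> E"
  using triangle_free by blast

lemma pack1: "(u, v) \<in> E \<Longrightarrow> f u \<noteq> f v"
  using pack[of u v 1] irrefl pos[of u] by auto

lemma pack2: "(u, w) \<in> E \<Longrightarrow> (w, v) \<in> E \<Longrightarrow> u \<noteq> v \<Longrightarrow> f u = f v \<Longrightarrow> f u < 2"
  using pack[of u v 2] by (auto simp: numeral_2_eq_2)

lemma pack3:
  "(u, w) \<in> E \<Longrightarrow> (w, x) \<in> E \<Longrightarrow> (x, v) \<in> E \<Longrightarrow> u \<noteq> v \<Longrightarrow> f u = f v \<Longrightarrow> f u < 3"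
  using pack[of u v 3] by (auto simp: numeral_3_eq_3)

lemma pack4:
  "(u, w) \<in> E \<Longrightarrow> (w, x) \<in> E \<Longrightarrow> (x, y) \<in> E \<Longrightarrow> (y, v) \<in> E \<Longrightarrow> u \<noteq> v \<Longrightarrow> f u = f v \<Longrightarrow> f u < 4"
  using pack[of u v 4] by (auto simp: eval_nat_numeral)

text \<open>Distinctness of the five vertices is not demanded; triangle-freeness forces it.\<close>

definition pentagon :: "'a \<Rightarrow> 'a \<Rightarrow> 'a \<Rightarrow> 'a \<Rightarrow> 'a \<Rightarrow> bool" where
  "pentagon z x p q y \<longleftrightarrow> {(z, x), (x, p), (p, q), (q, y), (y, z)} \<subseteq> E \<and>
     f ` {z, x, p, q, y} \<subseteq> {2..6}"

definition Z :: "'a set" where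
  "Z = {z. f z = 2 \<and> (\<exists>x p q y. pentagon z x p q y)}"

definition B :: "'a set" where
  "B = {v. f v \<in> {2..6} \<and> v \<notin> Z}"

definition U :: "'a set" where
  "U = {u. f u = 1 \<and> (\<exists>z\<in>Z. (u, z) \<in> E)}"

text \<open>Any two vertices of a pentagon are at distance at most 2, so colours from 2 on cannot
  repeat.\<close>

lemma pentagon_colours:
  assumes "pentagon z x p q y"
  shows "f ` {z, x, p, q, y} = {2..6}"
proof -
  have e: "(z, x) \<in> E" "(x, p) \<in> E" "(p, q) \<in> E" "(q, y) \<in> E" "(y, z) \<in> E"
    and c: "f ` {z, x, p, q, y} \<subseteq> {2..6}" using assms unfolding pentagon_def by auto
  have "z \<noteq> p" "x \<noteq> q" "p \<noteq> y" "q \<noteq> z" "y \<noteq> x" using e triangle_free by blast+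
  with e c pack2[of z x p] pack2[of x p q] pack2[of p q y] pack2[of q y z] pack2[of y z x]
  have "f z \<noteq> f p" "f x \<noteq> f q" "f p \<noteq> f y" "f q \<noteq> f z" "f y \<noteq> f x" by auto
  moreover have "f z \<noteq> f x" "f x \<noteq> f p" "f p \<noteq> f q" "f q \<noteq> f y" "f y \<noteq> f z"
    using e pack1 by blast+
  ultimately have "card (f ` {z, x, p, q, y}) = 5" by simp
  with c show ?thesis by (intro card_subset_eq) auto
qed

lemma no_odd_closed_walk_in_B:
  assumes "odd n"
  shows "(v, v) \<notin> (E \<inter> B \<times> B) ^^ n"
proof
  assume "(v, v) \<in> (E \<inter> B \<times> B) ^^ n"
  from shortest_odd_closed_walk[OF this assms] obtain m s where
    m: "odd m" and per: "\<And>i. s (i + m) = s i" and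
    s: "\<And>i. (s i, s (Suc i)) \<in> E \<inter> B \<times> B" and inj: "inj_on s {..<m}" by metis
  have E: "(s i, s (Suc i)) \<in> E" and B: "s i \<in> B" for i using s[of i] by auto
  have cols: "f (s i) \<in> {2..6}" for i using B[of i] unfolding B_def by simp
  have "m = 1 \<or> m = 3 \<or> m = 5 \<or> 7 \<le> m" using m by presburger
  then consider "m = 1" | "m = 3" | "m = 5" | "7 \<le> m" by blast
  then show False
  proof cases
    case 1
    with per[of 0] E[of 0] irrefl show False by simp
  next
    case 2
    with per[of 0] E[of 0] E[of 1] E[of 2] triangle_free[of "s 0" "s 1" "s 2"]
    show False by (simp add: eval_nat_numeral)
  next
    case 3
    have pent: "pentagon (s i) (s (i + 1)) (s (i + 2)) (s (i + 3)) (s (i + 4))" for i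
      using E[of i] E[of "i + 1"] E[of "i + 2"] E[of "i + 3"] E[of "i + 4"] per[of i] cols 3
      unfolding pentagon_def by (auto simp: eval_nat_numeral)
    \<comment> \<open>All five colours occur, so the pentagon can be rotated to start at a vertex of
      colour 2, which then lies in \<open>Z\<close>.\<close>
    have "2 \<in> f ` {s 0, s 1, s 2, s 3, s 4}"
      using pentagon_colours[OF pent[of 0]] by (simp add: eval_nat_numeral)
    then obtain i where "f (s i) = 2" by auto
    with pent[of i] have "s i \<in> Z" unfolding Z_def by blast
    with B[of i] show False unfolding B_def by simp
  next
    case 4
    have seg: "(s i, s (i + d)) \<in> E ^^ d" for i d
      unfolding relpow_fun_conv using E by (intro exI[of _ "\<lambda>t. s (i + t)"]) auto
    have smod: "s i = s (i mod m)" for i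
    proof -
      have "s (j + t * m) = s j" for j t
        by (induction t) (use per in \<open>auto simp: add.assoc[symmetric] add.commute[of m]\<close>)
      from this[of "i mod m" "i div m"] show ?thesis by simp
    qed
    have "f (s (i + d)) \<noteq> f (s i)" if d: "0 < d" "d \<le> f (s i)" for i d
    proof
      assume eq: "f (s (i + d)) = f (s i)"
      \<comment> \<open>Colours are at most 6 and the cycle has length at least 7, so the two
        positions cannot coincide by wrapping around.\<close>
      have "d < m" using d cols[of i] 4 by simp
      have "s (i + d) \<noteq> s i"
      proof
        assume "s (i + d) = s i"
        then have "(i + d) mod m = i mod m"
          using smod[of i] smod[of "i + d"] inj 4 by (auto dest!: inj_onD)
        then have "m dvd d" by (metis add_diff_cancel_left' le_add1 mod_eq_dvd_iff_nat)
        with d(1) \<open>d < m\<close> show False by (auto dest: dvd_imp_le)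
      qed
      with pack[OF seg[of i d]] eq d show False by simp
    qed
    then show False using no_packing_sequence[of "\<lambda>i. f (s i)"] cols by blast
  qed
qed

text \<open>A neighbour of \<open>u\<close> in \<open>B\<close> is within distance 3 of
  \<open>x\<close> and \<open>y\<close>, and within 4 of \<open>p\<close> and \<open>q\<close>.
  These four carry the colours 3 to 6, so a neighbour off the pentagon can only have colour
  3.\<close>

lemma U_unique_neighbour_in_B:
  assumes "u \<in> U" "(u, w) \<in> E" "(u, w') \<in> E" "w \<in> B" "w' \<in> B"
  shows "w = w'"
proof (rule ccontr)
  assume "w \<noteq> w'"
  obtain z x p q y where z: "f z = 2" "(u, z) \<in> E" "z \<in> Z" and P: "pentagon z x p q y"
    using assms(1) unfolding U_def Z_def by blast
  have "(x, z) \<in> E" "(p, x) \<in> E" "(q, p) \<in> E" "(y, q) \<in> E" "(z, y) \<in> E" "(z, u) \<in> E"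
    "(z, x) \<in> E" "(x, p) \<in> E" "(p, q) \<in> E" "(q, y) \<in> E" "(y, z) \<in> E"
    using P z(2) sym unfolding pentagon_def by (auto dest: symD)
  note edges = this
  have cyc: "c \<in> f ` {x, p, q, y}" if "c \<in> {3..6}" for c
  proof -
    have "c \<in> f ` {z, x, p, q, y}" using that pentagon_colours[OF P] by auto
    then show ?thesis using that z(1) by auto
  qed
  have on_cycle: "v \<in> {p, q} \<or> (f v = 3 \<and> (u, p) \<notin> E \<and> (u, q) \<notin> E)"
    if v: "(u, v) \<in> E" "v \<in> B" for v
  proof -
    have vu: "(v, u) \<in> E" using v(1) sym by (rule symD[rotated])
    have "v \<noteq> z" using v(2) z(3) unfolding B_def by auto
    then have "f v \<noteq> 2" using pack2[OF vu z(2)] z(1) by auto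
    then have fv: "f v \<in> {3..6}" using v(2) unfolding B_def by auto
    have nxy: "v \<noteq> x" "v \<noteq> y" using v(1) edges triangle_free by blast+
    obtain t where t: "t \<in> {x, p, q, y}" "f v = f t" using cyc[OF fv] by auto
    show ?thesis
    proof (cases "v = t")
      case True
      with t(1) nxy show ?thesis by auto
    next
      case False
      have "t \<noteq> x" using pack3[OF vu z(2), of x] edges False t(2) fv by auto
      moreover have "t \<noteq> y" using pack3[OF vu z(2), of y] edges False t(2) fv by auto
      ultimately have tpq: "t = p \<or> t = q" using t(1) by auto
      then have "f v < 4"
        using pack4[OF vu z(2), of x p] pack4[OF vu z(2), of y q] edges False t(2) by auto
      moreover have "(u, p) \<notin> E" "(u, q) \<notin> E"
        using tpq pack2[OF vu, of t] pack3[OF vu, of p q] pack3[OF vu, of q p] edges False t(2) fv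
        by auto
      ultimately show ?thesis using fv by auto
    qed
  qed
  \<comment> \<open>Two neighbours of colour 3 would clash, both \<open>p\<close> and
    \<open>q\<close> would give a triangle, and the mixed case contradicts
    \<open>on_cycle\<close>.\<close>
  have "f w \<noteq> f w'"
    using pack2[of w u w'] assms sym \<open>w \<noteq> w'\<close> unfolding B_def by (auto dest: symD)
  moreover have "\<not> ((u, p) \<in> E \<and> (u, q) \<in> E)" using edges triangle_free sym by (meson symD)
  ultimately show False
    using on_cycle[of w] on_cycle[of w'] assms \<open>w \<noteq> w'\<close> by auto
qed

lemma three_colouring:
  "\<exists>h :: 'a \<Rightarrow> nat. (\<forall>v. h v \<in> {1..3}) \<and> (\<forall>(u, v)\<in>E. f u \<le> 6 \<longrightarrow> f v \<le> 6 \<longrightarrow> h u \<noteq> h v)"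
proof -
  have "sym (E \<inter> B \<times> B)" using sym by (auto intro!: symI dest: symD)
  then obtain g :: "'a \<Rightarrow> bool"
    where g: "\<And>u v. (u, v) \<in> E \<Longrightarrow> u \<in> B \<Longrightarrow> v \<in> B \<Longrightarrow> g u \<noteq> g v"
    using two_colouring_of_no_odd_closed_walk[OF _ no_odd_closed_walk_in_B] by blast
  define h :: "'a \<Rightarrow> nat" where
    \<comment> \<open>Among vertices of colour at most 6, value 1 goes to \<open>Z\<close> and to
      the colour-1 vertices outside \<open>U\<close>, which have no neighbour in \<open>Z\<close>. A
      vertex of \<open>U\<close> avoids the value of its only neighbour in \<open>B\<close>, with 2
      as default.\<close>
    "h v = (if v \<in> B then if g v then 2 else 3
      else if v \<in> U then if \<exists>w\<in>B. (v, w) \<in> E \<and> g w then 3 else 2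
      else 1)" for v
  have UB: "h u \<noteq> h v" if "(u, v) \<in> E" "u \<in> U" "v \<in> B" for u v
  proof -
    have "u \<notin> B" using that(2) unfolding U_def B_def by auto
    moreover have "(\<exists>w\<in>B. (u, w) \<in> E \<and> g w) \<longleftrightarrow> g v"
      using U_unique_neighbour_in_B[OF that(2,1) _ that(3)] that(1,3) by blast
    ultimately show ?thesis using that(2,3) unfolding h_def by simp
  qed
  have cases: "v \<in> B \<or> v \<in> U \<or> v \<in> Z \<or> (f v = 1 \<and> v \<notin> U)" if "f v \<le> 6" for v
    using that pos[of v] unfolding B_def by auto
  have proper: "h u \<noteq> h v" if uv: "(u, v) \<in> E" and c: "f u \<le> 6" "f v \<le> 6" for u v
  proof -
    have vu: "(v, u) \<in> E" using sym uv by (rule symD)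
    have "u \<in> B \<and> v \<in> B \<Longrightarrow> h u \<noteq> h v" using g[OF uv] unfolding h_def by auto
    moreover have "u \<in> U \<and> v \<in> B \<or> u \<in> B \<and> v \<in> U \<Longrightarrow> h u \<noteq> h v"
      using UB[OF uv] UB[OF vu] by auto
    moreover have "\<not> (f u = 1 \<and> f v = 1)" "\<not> (f u = 2 \<and> f v = 2)" using pack1[OF uv] by auto
    moreover have "f w = 1" if "w \<in> U" for w using that unfolding U_def by simp
    moreover have "f w = 2 \<and> w \<notin> B" if "w \<in> Z" for w using that unfolding Z_def B_def by simp
    moreover have "f w \<noteq> 1" if "w \<in> B" for w using that unfolding B_def by simp
    moreover have "f u = 1 \<Longrightarrow> v \<in> Z \<Longrightarrow> u \<in> U" "f v = 1 \<Longrightarrow> u \<in> Z \<Longrightarrow> v \<in> U"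
      using uv vu unfolding U_def by auto
    moreover have "h w = 1 \<longleftrightarrow> w \<notin> B \<and> w \<notin> U" for w unfolding h_def by auto
    ultimately show ?thesis using cases[OF c(1)] cases[OF c(2)] by (metis numeral_eq_one_iff semiring_norm(85))
  qed
  have "h v \<in> {1..3}" for v unfolding h_def by auto
  with proper show ?thesis by blast
qed

end

section \<open>From packing colourings to proper colourings\<close>

text \<open>Colours 1 to 6 merge into three and the others shift down by 3, which saves three of the
  \<open>k + 2\<close> colours. Since \<open>k\<close> is at least 4, the three new colours fit
  below \<open>k\<close>.\<close>

lemma chromatic_number_le_of_packing:
  assumes G: "pair_graph G" and clique: "clique_number G = 2"
    and V: "packing_partition G (k + 2) V" and k: "4 \<le> k"
  shows "chromatic_number G \<le> k - 1"
proof -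
  interpret pair_graph G by (rule G)
  \<comment> \<open>The bound \<open>1 \<le> i\<close> stands outside the implication because the
    locale wants positive colours off the vertex set too.\<close>
  have "\<forall>v. \<exists>i\<ge>1. v \<in> pverts G \<longrightarrow> i \<le> k + 2 \<and> v \<in> V i"
  proof
    fix v
    show "\<exists>i\<ge>1. v \<in> pverts G \<longrightarrow> i \<le> k + 2 \<and> v \<in> V i"
    proof (cases "v \<in> pverts G")
      case True
      then have "v \<in> (\<Union>i\<in>{1..k + 2}. V i)" using V unfolding packing_partition_def by simp
      then show ?thesis by auto
    qed auto
  qed
  then obtain f where f: "\<And>v. 1 \<le> f v" "\<And>v. v \<in> pverts G \<Longrightarrow> f v \<le> k + 2 \<and> v \<in> V (f v)"
    by metis
  have pack: "f u < m" if uv: "(u, v) \<in> parcs G ^^ m" "u \<noteq> v" "f u = f v" for u v m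
  proof -
    \<comment> \<open>As \<open>u\<close> and \<open>v\<close> differ, the walk has an arc, which
      places both ends in the vertex set.\<close>
    obtain m' where m': "m = Suc m'" using uv by (cases m) auto
    have "u \<in> pverts G" using uv(1) in_arcsD1 unfolding m' by (meson relpow_Suc_E2)
    moreover have "v \<in> pverts G" using uv(1) in_arcsD2 unfolding m' by (meson relpow_Suc_E)
    ultimately have "u \<in> V (f u)" "v \<in> V (f u)" "f u \<in> {1..k + 2}"
      using f(1)[of u] f(2)[of u] f(2)[of v] uv(3) by simp_all
    then have "ereal (real (f u)) < graph_dist G u v"
      using V uv(2) unfolding packing_partition_def is_packing_def by blast
    also have "\<dots> \<le> ereal (real m)"
      using \<open>u \<in> pverts G\<close> by (intro graph_dist_le_of_relpow uv(1)) unfold_locales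
    finally show ?thesis by simp
  qed
  have sym: "sym (parcs G)" using pair_sym_arcs unfolding symmetric_def by simp
  have irrefl: "(x, x) \<notin> parcs G" for x using pair_no_loops by fastforce
  have triangle: "(z, x) \<notin> parcs G" if "(x, y) \<in> parcs G" "(y, z) \<in> parcs G" for x y z
  proof
    assume "(z, x) \<in> parcs G"
    with that have "is_clique G {x, y, z}"
      using sym in_arcsD1 unfolding is_clique_def by (auto dest: symD)
    then have "card {x, y, z} \<le> 2" using clique_card_le_clique_number[of G] clique by simp
    moreover have "x \<noteq> y" "y \<noteq> z" "z \<noteq> x" using that \<open>(z, x) \<in> parcs G\<close> irrefl by auto
    ultimately show False by simp
  qed
  interpret triangle_free_packing "parcs G" f
    by (rule triangle_free_packing.intro) (fact sym triangle f(1) pack)+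
  obtain h :: "'a \<Rightarrow> nat" where h: "\<And>v. h v \<in> {1..3}"
    "\<And>u v. (u, v) \<in> parcs G \<Longrightarrow> f u \<le> 6 \<Longrightarrow> f v \<le> 6 \<Longrightarrow> h u \<noteq> h v"
    using three_colouring by blast
  define c where "c v = (if f v \<le> 6 then h v else f v - 3)" for v
  have "c u \<noteq> c v" if "(u, v) \<in> parcs G" for u v
    using h(1)[of u] h(1)[of v] h(2)[OF that] pack1[OF that] unfolding c_def by auto
  moreover have "c v \<in> {1..k - 1}" if "v \<in> pverts G" for v
    using h(1)[of v] f(2)[OF that] k unfolding c_def by auto
  ultimately have "proper_coloring G (k - 1) c" unfolding proper_coloring_def by auto
  then show ?thesis unfolding chromatic_number_def by (intro Least_le) blast
qed

theorem theorem3p6: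
  fixes k :: nat
  assumes "k \<ge> 4"
  shows "\<not> (\<exists>G :: 'a pair_pre_digraph. pair_graph G \<and> clique_number G = 2 \<and>
    chromatic_number G = k \<and> packing_chromatic_number G = k + 2)"
proof
  assume "\<exists>G :: 'a pair_pre_digraph. pair_graph G \<and> clique_number G = 2 \<and>
    chromatic_number G = k \<and> packing_chromatic_number G = k + 2"
  then obtain G :: "'a pair_pre_digraph" where G: "pair_graph G" "clique_number G = 2"
    "chromatic_number G = k" "packing_chromatic_number G = k + 2" by blast
  interpret pair_graph G by (rule G(1))
  obtain V where "packing_partition G (k + 2) V"
    using packing_partition_packing_chromatic_number[OF pair_finite_verts] G(4) by auto
  from chromatic_number_le_of_packing[OF G(1,2) this assms] G(3) assms show False by simp
qed

end
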